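(* Let $W=x_1^{j_1}\cdots x_{n-1}^{j_{n-1}}\in B_x$ with $j_1\ge j_2\ge\cdots\ge j_{n-1}$, and let $m=\max\{k\in[0,n-1]\mid P^W_k\ne\emptyset\}$. If $m>0$, then for every $k\in[1,m]$, $$\partial_{v^W_kv^W_{k-1}\cdots v^W_1}\mathfrak{S}_{w_0^n}=\frac{x_1^{n-1}x_2^{n-2}\cdots x_{n-1}^1}{\prod_{l=1}^{k}\ \prod_{p\in P^W_l}x_p}.$$ In particular, $\partial_{v^W_mv^W_{m-1}\cdots v^W_1}\mathfrak{S}_{w_0^n}=W$.
   Context: $[i,j]=\{i,\ldots,j\}$ for integers $i\le j$. $B_x=\{x_1^{k_1}\cdots x_{n-1}^{k_{n-1}}\mid k_i\ge0,\ k_i+i\le n,\ 1\le i\le n-1\}$. $\mathfrak{S}_{w_0^n}=x_1^{n-1}x_2^{n-2}\cdots x_{n-1}$. $s_if$ is the result of interchanging $x_i,x_{i+1}$ in the polynomial $f$, and $\partial_i(f)=\frac{f-s_if}{x_i-x_{i+1}}$ for $1\le i\le n-1$. For a word $u=s_{a_1}s_{a_2}\cdots s_{a_p}$ in the generators $s_1,\ldots,s_{n-1}$, $\partial_u=\partial_{a_1}\partial_{a_2}\cdots\partial_{a_p}$ (composition, rightmost applied first). For $W=x_1^{j_1}\cdots x_{n-1}^{j_{n-1}}\in B_x$ with $j_1\ge\cdots\ge j_{n-1}$ and $k\ge 0$, put $P^W_k=\{p\in[1,n-1]\mid n-p-j_p\ge k\}=\{p_{k,1}<p_{k,2}<\cdots<p_{k,t_k}\}$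 (so $P^W_0=[1,n-1]$). If $k>0$ and $P^W_k\ne\emptyset$, put $v^W_k=s_{p_{k,t_k}}\cdots s_{p_{k,2}}s_{p_{k,1}}$. *)

theory Defs
  imports
    "HOL-Library.Poly_Mapping"
    "HOL-Computational_Algebra.Polynomial_Factorial"
    "HOL-Combinatorics.Transposition"
begin

text \<open>
  Polynomials over \<open>'a\<close> in the commuting variables \<open>x\<^sub>0, x\<^sub>1, x\<^sub>2, \<dots>\<close>, as finitely supported
  maps from exponent vectors to coefficients. The polynomials in \<open>x\<^sub>1, \<dots>, x\<^sub>n\<close> are those of
  them in which no other variable occurs.
\<close>

type_synonym 'a mpoly = "(nat \<Rightarrow>\<^sub>0 nat) \<Rightarrow>\<^sub>0 'a"

definition X :: "nat \<Rightarrow> 'a::idom mpoly" where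
  "X i = Poly_Mapping.single (Poly_Mapping.single i 1) 1"

text \<open>
  \<open>map_key g p = p \<circ> g\<close> for injective \<open>g\<close>: the inner \<open>map_key\<close> interchanges the entries \<open>i\<close> and
  \<open>i + 1\<close> of an exponent vector.
\<close>

definition swap_vars :: "nat \<Rightarrow> 'a::idom mpoly \<Rightarrow> 'a mpoly" where
  "swap_vars i f =
     Poly_Mapping.map_key (Poly_Mapping.map_key (Transposition.transpose i (Suc i))) f"

text \<open>
  The quotient is taken in the fraction field; \<open>to_fract_ddiff\<close> below shows that it is
  always a polynomial, so that the description is proper.
\<close>

definition ddiff :: "nat \<Rightarrow> 'a::idom mpoly \<Rightarrow> 'a mpoly" where
  "ddiff i f = (THE g. to_fract g = to_fract (f - swap_vars i f) / to_fract (X i - X (Suc i)))"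

text \<open>A word \<open>s\<^sub>a s\<^sub>b \<dots> s\<^sub>c\<close> is represented by the list \<open>[a, b, \<dots>, c]\<close>.\<close>

definition ddiff_word :: "nat list \<Rightarrow> 'a::idom mpoly \<Rightarrow> 'a mpoly" where
  "ddiff_word u f = foldr ddiff u f"

definition Bx :: "nat \<Rightarrow> 'a::idom mpoly set" where
  "Bx n = {(\<Prod>i = 1..n - 1. X i ^ k i) | k :: nat \<Rightarrow> nat. \<forall>i\<in>{1..n - 1}. k i + i \<le> n}"

definition schubert_w0 :: "nat \<Rightarrow> 'a::idom mpoly" where
  "schubert_w0 n = (\<Prod>i = 1..n - 1. X i ^ (n - i))"

text \<open>In the following, \<open>j\<close> is the exponent sequence of the monomial \<open>W\<close>.\<close>

definition P :: "nat \<Rightarrow> (nat \<Rightarrow> nat) \<Rightarrow> nat \<Rightarrow> nat set" where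
  "P n j k = {p \<in> {1..n - 1}. int n - int p - int (j p) \<ge> int k}"

definition v :: "nat \<Rightarrow> (nat \<Rightarrow> nat) \<Rightarrow> nat \<Rightarrow> nat list" where
  "v n j k = rev (sorted_list_of_set (P n j k))"

text \<open>The concatenated word \<open>v\<^sub>k v\<^sub>k\<^sub>-\<^sub>1 \<dots> v\<^sub>1\<close>.\<close>

definition v_word :: "nat \<Rightarrow> (nat \<Rightarrow> nat) \<Rightarrow> nat \<Rightarrow> nat list" where
  "v_word n j k = concat (map (v n j) (rev [1..<Suc k]))"


subsection \<open>Well-definedness of the operators\<close>

lemma lookup_map_key_transpose:
  "Poly_Mapping.lookup (Poly_Mapping.map_key (Transposition.transpose i k) e) p =
     Poly_Mapping.lookup e (Transposition.transpose i k p)"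
  by (simp add: map_key.rep_eq)

lemma map_key_transpose_involutory:
  "Poly_Mapping.map_key (Transposition.transpose i k)
     (Poly_Mapping.map_key (Transposition.transpose i k) e) = e"
  by (rule poly_mapping_eqI) (simp add: lookup_map_key_transpose)

lemma inj_map_key_transpose: "inj (Poly_Mapping.map_key (Transposition.transpose i k))"
  by (rule inj_on_inverseI) (rule map_key_transpose_involutory)

lemma lookup_swap_vars:
  "Poly_Mapping.lookup (swap_vars i f) e =
     Poly_Mapping.lookup f (Poly_Mapping.map_key (Transposition.transpose i (Suc i)) e)"
  by (simp add: swap_vars_def map_key.rep_eq inj_map_key_transpose)

lemma swap_vars_add: "swap_vars i (f + g) = swap_vars i f + swap_vars i g"
  by (rule poly_mapping_eqI) (simp add: lookup_swap_vars lookup_add)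

lemma swap_vars_single:
  "swap_vars i (Poly_Mapping.single e c) =
     Poly_Mapping.single (Poly_Mapping.map_key (Transposition.transpose i (Suc i)) e) c"
proof (rule poly_mapping_eqI)
  fix d
  have "e = Poly_Mapping.map_key (Transposition.transpose i (Suc i)) d \<longleftrightarrow>
      Poly_Mapping.map_key (Transposition.transpose i (Suc i)) e = d"
    using map_key_transpose_involutory by metis
  then show "Poly_Mapping.lookup (swap_vars i (Poly_Mapping.single e c)) d =
      Poly_Mapping.lookup
        (Poly_Mapping.single (Poly_Mapping.map_key (Transposition.transpose i (Suc i)) e) c) d"
    by (simp add: lookup_swap_vars lookup_single)
qed

lemma swap_vars_X: "swap_vars i (X p) = X (Transposition.transpose i (Suc i) p)"
proof -
  have "Poly_Mapping.map_key (Transposition.transpose i (Suc i)) (Poly_Mapping.single p (1::nat)) =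
      Poly_Mapping.single (Transposition.transpose i (Suc i) p) 1"
    by (rule poly_mapping_eqI)
      (auto simp: lookup_map_key_transpose lookup_single when_def)
  then show ?thesis by (simp add: X_def swap_vars_single)
qed

lemma X_power: "X i ^ a = Poly_Mapping.single (Poly_Mapping.single i a) (1 :: 'a::idom)"
  by (induction a) (simp_all add: X_def mult_single single_add[symmetric])

lemma X_eq_iff: "(X i :: 'a::idom mpoly) = X k \<longleftrightarrow> i = k"
  unfolding X_def by (metis lookup_single_eq lookup_single_not_eq one_neq_zero)

lemma diff_dvd_power_diff: "(x - y) dvd (x ^ a - y ^ a)" for x y :: "'b::comm_ring_1"
  by (metis dvd_triv_left power_diff_sumr2)

lemma dvd_swap_vars_diff: "X i - X (Suc i) dvd f - swap_vars i (f :: 'a::idom mpoly)"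
proof (induction f rule: Poly_Mapping.update_induct)
  case const
  have "swap_vars i (0 :: 'a mpoly) = 0"
    by (rule poly_mapping_eqI) (simp add: lookup_swap_vars)
  then show ?case by simp
next
  case (update f e c)
  define a b where "a = Poly_Mapping.lookup e i" and "b = Poly_Mapping.lookup e (Suc i)"
  define r where "r = Poly_Mapping.update i 0 (Poly_Mapping.update (Suc i) 0 e)"
  let ?x = "X i :: 'a mpoly" and ?y = "X (Suc i) :: 'a mpoly" and ?r = "Poly_Mapping.single r c"
  have e: "e = r + Poly_Mapping.single i a + Poly_Mapping.single (Suc i) b"
    by (rule poly_mapping_eqI)
      (auto simp: a_def b_def r_def lookup_add lookup_update lookup_single when_def)
  have e': "Poly_Mapping.map_key (Transposition.transpose i (Suc i)) e =
      r + Poly_Mapping.single (Suc i) a + Poly_Mapping.single i b"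
    by (rule poly_mapping_eqI)
      (auto simp: a_def b_def r_def lookup_add lookup_update lookup_single when_def
         lookup_map_key_transpose Transposition.transpose_def)
  have "Poly_Mapping.single e c - swap_vars i (Poly_Mapping.single e c) =
      ?r * ?x ^ a * ?y ^ b - ?r * ?y ^ a * ?x ^ b"
    unfolding swap_vars_single e' by (subst e) (simp add: X_power mult_single)
  also have "\<dots> = ?r * (?y ^ b * (?x ^ a - ?y ^ a) - ?y ^ a * (?x ^ b - ?y ^ b))"
    by (simp add: algebra_simps)
  finally have "X i - X (Suc i) dvd
      Poly_Mapping.single e c - swap_vars i (Poly_Mapping.single e c)"
    using diff_dvd_power_diff[of ?x ?y a] diff_dvd_power_diff[of ?x ?y b]
    by simp
  moreover have "Poly_Mapping.update e c f = f + Poly_Mapping.single e c"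
    using update.hyps(1)
    by (intro poly_mapping_eqI)
      (auto simp: lookup_add lookup_update lookup_single when_def in_keys_iff)
  ultimately show ?case
    using update.IH by (simp add: swap_vars_add add_diff_add)
qed

lemma to_fract_ddiff:
  "to_fract (ddiff i f) = to_fract (f - swap_vars i f) / to_fract (X i - X (Suc i))"
proof -
  obtain g where g: "f - swap_vars i f = (X i - X (Suc i)) * g"
    using dvd_swap_vars_diff by blast
  have h: "to_fract g = to_fract (f - swap_vars i f) / to_fract (X i - X (Suc i))"
    by (simp add: g X_eq_iff del: to_fract_diff)
  show ?thesis
    unfolding ddiff_def by (rule theI, rule h) (metis h to_fract_eq_iff)
qed

end

theory Submission
  imports Defs
begin

text \<open>
  If \<open>x\<^sub>p\<close> occurs in a monomial with exactly one more power than \<open>x\<^bsub>p+1\<^esub>\<close>, then \<open>\<partial>\<^sub>p\<close> divides the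
  monomial by \<open>x\<^sub>p\<close>. By induction, after \<open>k\<close> blocks the exponent of \<open>x\<^sub>p\<close> is \<open>max (n - p - k) j\<^sub>p\<close>.
  The block \<open>v\<^bsub>k+1\<^esub>\<close> treats the elements of \<open>P\<^bsub>k+1\<^esub>\<close> in increasing order, so \<open>x\<^bsub>p+1\<^esub>\<close> is still
  untouched when \<open>\<partial>\<^sub>p\<close> is applied, and \<open>j\<^bsub>p+1\<^esub> \<le> j\<^sub>p\<close> forces its exponent to be \<open>n - p - 1 - k\<close>,
  one less than that of \<open>x\<^sub>p\<close>. As \<open>P\<^bsub>m+1\<^esub>\<close> is empty, the exponents for \<open>k = m\<close> are the \<open>j\<^sub>p\<close>.
\<close>

text \<open>Replaces the quotient in the fraction field by an identity of polynomials:
  \<open>X i - X (Suc i)\<close> is nonzero and \<open>to_fract\<close> is injective.\<close>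

lemma ddiff_eqI:
  assumes "f - swap_vars i f = (X i - X (Suc i)) * g"
  shows "ddiff i f = (g :: 'a::idom mpoly)"
proof -
  have "to_fract (ddiff i f) = to_fract g"
    by (simp add: to_fract_ddiff assms X_eq_iff del: to_fract_diff)
  then show ?thesis by simp
qed

lemma ddiff_single:
  fixes c :: "'a::idom"
  assumes "Poly_Mapping.lookup e i = Suc (Poly_Mapping.lookup e (Suc i))"
  shows "ddiff i (Poly_Mapping.single e c) =
    Poly_Mapping.single (e - Poly_Mapping.single i 1) c"
proof (rule ddiff_eqI)
  let ?d = "e - Poly_Mapping.single i 1"
  have e: "e = Poly_Mapping.single i 1 + ?d"
    using assms by (intro poly_mapping_eqI)
      (auto simp: lookup_add lookup_minus lookup_single when_def)
  \<comment> \<open>By the assumption, \<open>?d\<close> has equal entries at \<open>i\<close> and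
    \<open>Suc i\<close>, so the interchange fixes it and moves only the extra factor
    \<open>X i\<close>.\<close>
  have e': "Poly_Mapping.map_key (Transposition.transpose i (Suc i)) e =
      Poly_Mapping.single (Suc i) 1 + ?d"
    using assms by (intro poly_mapping_eqI)
      (auto simp: lookup_add lookup_minus lookup_single when_def lookup_map_key_transpose
         Transposition.transpose_def)
  have "Poly_Mapping.single e c = X i * Poly_Mapping.single ?d c"
    by (subst e) (simp add: X_def mult_single)
  moreover have "swap_vars i (Poly_Mapping.single e c) = X (Suc i) * Poly_Mapping.single ?d c"
    unfolding swap_vars_single e' by (simp add: X_def mult_single)
  ultimately show "Poly_Mapping.single e c - swap_vars i (Poly_Mapping.single e c) =
      (X i - X (Suc i)) * Poly_Mapping.single ?d c"
    by (simp add: algebra_simps)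
qed

text \<open>In the reversed word the head of \<open>xs\<close> acts first. It lowers only the
  exponent at \<open>x\<close>, while the condition for a later \<open>p > x\<close> concerns
  \<open>p\<close> and \<open>Suc p\<close>, so that condition survives.\<close>

lemma ddiff_word_rev_single:
  fixes c :: "'a::idom"
  assumes "sorted_wrt (<) xs"
    and "\<And>p. p \<in> set xs \<Longrightarrow> Poly_Mapping.lookup e p = Suc (Poly_Mapping.lookup e (Suc p))"
  shows "ddiff_word (rev xs) (Poly_Mapping.single e c) =
    Poly_Mapping.single (e - (\<Sum>p\<in>set xs. Poly_Mapping.single p 1)) c"
  using assms
proof (induction xs arbitrary: e)
  case Nil
  then show ?case by (simp add: ddiff_word_def)
next
  case (Cons x xs)
  let ?d = "e - Poly_Mapping.single x 1"
  have "ddiff_word (rev xs) (Poly_Mapping.single ?d c) =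
      Poly_Mapping.single (?d - (\<Sum>p\<in>set xs. Poly_Mapping.single p 1)) c"
  proof (rule Cons.IH)
    fix p assume p: "p \<in> set xs"
    then have "x < p" using Cons.prems(1) by simp
    then show "Poly_Mapping.lookup ?d p = Suc (Poly_Mapping.lookup ?d (Suc p))"
      using Cons.prems(2)[of p] p by (simp add: lookup_minus lookup_single)
  qed (use Cons.prems(1) in simp)
  moreover have "x \<notin> set xs" using Cons.prems(1) by auto
  moreover have "ddiff x (Poly_Mapping.single e c) = Poly_Mapping.single ?d c"
    using Cons.prems(2) by (intro ddiff_single) simp
  ultimately show ?case
    by (simp add: ddiff_word_def diff_diff_eq)
qed

lemma lookup_sum_single:
  assumes "finite A"
  shows "Poly_Mapping.lookup (\<Sum>p\<in>A. Poly_Mapping.single p (e p)) q = (if q \<in> A then e q else 0)"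
  using assms by (simp add: lookup_sum lookup_single when_def)

lemma prod_X_power:
  "(\<Prod>p\<in>A. X p ^ e p :: 'a::idom mpoly) =
    Poly_Mapping.single (\<Sum>p\<in>A. Poly_Mapping.single p (e p)) 1"
  by (induction A rule: infinite_finite_induct) (simp_all add: X_power mult_single)

text \<open>Serves to carry the bound in \<open>Bx\<close>, which is given for some exponent
  sequence of the monomial, over to a prescribed one.\<close>

lemma prod_X_power_eqD:
  assumes "(\<Prod>p\<in>A. X p ^ d p) = (\<Prod>p\<in>A. X p ^ e p :: 'a::idom mpoly)"
    and "finite A" "q \<in> A"
  shows "d q = e q"
proof -
  have "(\<Sum>p\<in>A. Poly_Mapping.single p (d p)) = (\<Sum>p\<in>A. Poly_Mapping.single p (e p))"
    using assms(1) unfolding prod_X_power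
    by (metis lookup_single_eq lookup_single_not_eq one_neq_zero)
  then show ?thesis
    using lookup_sum_single[OF \<open>finite A\<close>, of _ q] \<open>q \<in> A\<close> by metis
qed

text \<open>The value 0 in the hypothesis is the exponent of a variable outside \<open>A\<close>;
  for \<open>A = {1..n - 1}\<close> and \<open>p = n - 1\<close> this variable is x_n.\<close>

lemma ddiff_word_rev_prod:
  fixes e :: "nat \<Rightarrow> nat"
  assumes "finite A" "B \<subseteq> A"
    and "\<And>p. p \<in> B \<Longrightarrow> e p = Suc (if Suc p \<in> A then e (Suc p) else 0)"
  shows "ddiff_word (rev (sorted_list_of_set B)) (\<Prod>p\<in>A. X p ^ e p :: 'a::idom mpoly) =
    (\<Prod>p\<in>A. X p ^ (e p - (if p \<in> B then 1 else 0)))"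
proof -
  have B: "finite B" using assms finite_subset by blast
  have "(\<Sum>p\<in>A. Poly_Mapping.single p (e p)) - (\<Sum>p\<in>B. Poly_Mapping.single p 1) =
      (\<Sum>p\<in>A. Poly_Mapping.single p (e p - (if p \<in> B then 1 else 0)))"
    using assms B by (intro poly_mapping_eqI) (auto simp: lookup_minus lookup_sum_single)
  then show ?thesis
    using assms B unfolding prod_X_power
    by (subst ddiff_word_rev_single) (auto simp: lookup_sum_single)
qed

text \<open>Positivity on \<open>B\<close> keeps the subtraction of natural numbers from being cut
  off at 0.\<close>

lemma prod_X_power_diff:
  fixes e :: "nat \<Rightarrow> nat"
  assumes "finite A" "B \<subseteq> A" "\<And>p. p \<in> B \<Longrightarrow> e p > 0"
  shows "(\<Prod>p\<in>A. X p ^ (e p - (if p \<in> B then 1 else 0))) * (\<Prod>p\<in>B. X p) =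
    (\<Prod>p\<in>A. X p ^ e p :: 'a::idom mpoly)"
proof -
  have "(\<Prod>p\<in>B. X p :: 'a mpoly) = (\<Prod>p\<in>A. X p ^ (if p \<in> B then 1 else 0))"
    using assms(1,2) by (intro prod.mono_neutral_cong_left) auto
  then show ?thesis
    using assms(3) by (auto simp flip: prod.distrib power_add intro!: prod.cong)
qed

lemma mem_P_iff: "p \<in> P n j k \<longleftrightarrow> p \<in> {1..n - 1} \<and> p + j p + k \<le> n"
  by (auto simp: P_def)

lemma v_word_Suc: "v_word n j (Suc k) = v n j (Suc k) @ v_word n j k"
  by (simp add: v_word_def)

text \<open>Membership in \<open>P n j (Suc k)\<close> means \<open>j p < n - p - k\<close>. Exactly
  then the maximum still exceeds \<open>j p\<close> and drops by one; otherwise it already equals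
  \<open>j p\<close> and stays there.\<close>

lemma max_exponent_Suc:
  assumes "p \<in> {1..n - 1}"
  shows "max (n - p - Suc k) (j p) =
    max (n - p - k) (j p) - (if p \<in> P n j (Suc k) then 1 else (0::nat))"
  using assms by (auto simp: mem_P_iff max_def)

lemma max_exponent_P:
  fixes j :: "nat \<Rightarrow> nat"
  assumes "antimono_on {1..n - 1} j" "p \<in> P n j (Suc k)"
  shows "max (n - p - k) (j p) =
    Suc (if Suc p \<in> {1..n - 1} then max (n - Suc p - k) (j (Suc p)) else 0)"
proof (cases "Suc p \<in> {1..n - 1}")
  case True
  then have "j (Suc p) \<le> j p"
    using assms by (intro monotone_onD[OF assms(1)]) (auto simp: mem_P_iff)
  then show ?thesis using assms(2) True by (auto simp: mem_P_iff max_def)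
\<comment> \<open>Here \<open>p = n - 1\<close>, so membership forces \<open>j p = 0\<close> and
  \<open>k = 0\<close>, and both sides are 1.\<close>
qed (use assms(2) in \<open>auto simp: mem_P_iff max_def\<close>)

text \<open>The second identity is the desired quotient with its denominator cleared, so that the
  induction stays among polynomials.\<close>

lemma ddiff_v_word:
  fixes j :: "nat \<Rightarrow> nat"
  assumes "antimono_on {1..n - 1} j" and "\<And>p. p \<in> {1..n - 1} \<Longrightarrow> j p + p \<le> n"
  shows "ddiff_word (v_word n j k) (schubert_w0 n) =
      (\<Prod>p = 1..n - 1. X p ^ max (n - p - k) (j p) :: 'a::idom mpoly)"
    and "(\<Prod>p = 1..n - 1. X p ^ max (n - p - k) (j p)) * (\<Prod>l = 1..k. \<Prod>p\<in>P n j l. X p) =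
      (\<Prod>p = 1..n - 1. X p ^ (n - p) :: 'a mpoly)"
proof (induction k)
  case 0
  have "max (n - p) (j p) = n - p" if "p \<in> {1..n - 1}" for p
    using assms(2)[OF that] by linarith
  then have "(\<Prod>p = 1..n - 1. X p ^ max (n - p) (j p)) =
      (\<Prod>p = 1..n - 1. X p ^ (n - p) :: 'a mpoly)"
    by (intro prod.cong) simp_all
  then show
    "ddiff_word (v_word n j 0) (schubert_w0 n) =
      (\<Prod>p = 1..n - 1. X p ^ max (n - p - 0) (j p) :: 'a mpoly)"
    "(\<Prod>p = 1..n - 1. X p ^ max (n - p - 0) (j p)) * (\<Prod>l = 1..0. \<Prod>p\<in>P n j l. X p) =
      (\<Prod>p = 1..n - 1. X p ^ (n - p) :: 'a mpoly)"
    by (simp_all add: v_word_def ddiff_word_def schubert_w0_def)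
next
  case (Suc k)
  let ?A = "{1..n - 1}" and ?B = "P n j (Suc k)" and ?e = "\<lambda>p. max (n - p - k) (j p)"
  have B: "?B \<subseteq> ?A" by (auto simp: P_def)
  have e: "(\<Prod>p\<in>?A. X p ^ max (n - p - Suc k) (j p) :: 'a mpoly) =
      (\<Prod>p\<in>?A. X p ^ (?e p - (if p \<in> ?B then 1 else 0)))"
    by (intro prod.cong refl arg_cong[where f = "\<lambda>a. X _ ^ a"] max_exponent_Suc)
  have P: "?e p = Suc (if Suc p \<in> ?A then ?e (Suc p) else 0)" if "p \<in> ?B" for p
    using max_exponent_P[OF assms(1) that] .
  have "ddiff_word (v_word n j (Suc k)) (schubert_w0 n) =
      ddiff_word (v n j (Suc k)) (ddiff_word (v_word n j k) (schubert_w0 n :: 'a mpoly))"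
    by (simp add: v_word_Suc ddiff_word_def)
  also have "\<dots> = (\<Prod>p\<in>?A. X p ^ (?e p - (if p \<in> ?B then 1 else 0)))"
    unfolding Suc.IH(1) v_def by (rule ddiff_word_rev_prod[OF finite_atLeastAtMost B P])
  finally show "ddiff_word (v_word n j (Suc k)) (schubert_w0 n) =
      (\<Prod>p\<in>?A. X p ^ max (n - p - Suc k) (j p) :: 'a mpoly)"
    unfolding e .
  have pos: "?e p > 0" if "p \<in> ?B" for p
    using P[OF that] by linarith
  have *: "(\<Prod>p\<in>?A. X p ^ max (n - p - Suc k) (j p) :: 'a mpoly) * (\<Prod>p\<in>?B. X p) =
      (\<Prod>p\<in>?A. X p ^ ?e p)"
    unfolding e by (rule prod_X_power_diff[OF finite_atLeastAtMost B pos])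
  then show "(\<Prod>p\<in>?A. X p ^ max (n - p - Suc k) (j p)) * (\<Prod>l = 1..Suc k. \<Prod>p\<in>P n j l. X p) =
      (\<Prod>p\<in>?A. X p ^ (n - p) :: 'a mpoly)"
    unfolding Suc.IH(2)[symmetric] *[symmetric] by (simp add: mult_ac)
qed

theorem lemma4p2:
  fixes n m :: nat and j :: "nat \<Rightarrow> nat" and W :: "'a::idom mpoly"
  assumes "n \<ge> 2"
    and "W = (\<Prod>p = 1..n - 1. X p ^ j p)"
    and "W \<in> Bx n"
    and "antimono_on {1..n - 1} j"
    and "m = Max {k \<in> {0..n - 1}. P n j k \<noteq> {}}"
    and "m > 0"
  shows "(\<forall>k \<in> {1..m}.
      to_fract (ddiff_word (v_word n j k) (schubert_w0 n) :: 'a mpoly) =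
        to_fract (\<Prod>p = 1..n - 1. X p ^ (n - p)) /
        to_fract (\<Prod>l = 1..k. \<Prod>p \<in> P n j l. X p)) \<and>
    ddiff_word (v_word n j m) (schubert_w0 n) = W"
proof -
  obtain d where d: "W = (\<Prod>p = 1..n - 1. X p ^ d p)" "\<forall>p\<in>{1..n - 1}. d p + p \<le> n"
    using assms(3) unfolding Bx_def by blast
  have j: "j p + p \<le> n" if "p \<in> {1..n - 1}" for p
    using prod_X_power_eqD[OF trans[OF d(1)[symmetric] assms(2)] finite_atLeastAtMost that] d(2) that
    by metis
  have dd: "ddiff_word (v_word n j k) (schubert_w0 n) =
      (\<Prod>p = 1..n - 1. X p ^ max (n - p - k) (j p) :: 'a mpoly)" for k
    using assms(4) j by (rule ddiff_v_word(1))
  have "to_fract (ddiff_word (v_word n j k) (schubert_w0 n) :: 'a mpoly) =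
      to_fract (\<Prod>p = 1..n - 1. X p ^ (n - p)) / to_fract (\<Prod>l = 1..k. \<Prod>p \<in> P n j l. X p)" for k
  proof -
    have fin: "finite (P n j l)" for l by (simp add: P_def)
    have X0: "X p \<noteq> (0 :: 'a mpoly)" for p
      by (metis X_def lookup_single_eq lookup_zero one_neq_zero)
    let ?Q = "\<Prod>l = 1..k. \<Prod>p \<in> P n j l. X p :: 'a mpoly"
    have "?Q \<noteq> 0"
      by (simp add: fin X0)
    moreover have "ddiff_word (v_word n j k) (schubert_w0 n) * ?Q = (\<Prod>p = 1..n - 1. X p ^ (n - p))"
      unfolding dd using assms(4) j by (rule ddiff_v_word(2))
    ultimately show ?thesis
      by (simp add: nonzero_eq_divide_eq flip: to_fract_mult)
  qed
  moreover have "max (n - p - m) (j p) = j p" if p: "p \<in> {1..n - 1}" for p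
  proof (rule ccontr)
    assume "max (n - p - m) (j p) \<noteq> j p"
    then have *: "p + j p + Suc m \<le> n" by auto
    \<comment> \<open>The index \<open>Suc m\<close> lies in the range of the maximum because
      \<open>p \<ge> 1\<close> gives \<open>Suc m \<le> n - 1\<close>.\<close>
    then have "Suc m \<in> {k \<in> {0..n - 1}. P n j k \<noteq> {}}"
      using p mem_P_iff[of p n j "Suc m"] by auto
    then have "Suc m \<le> m" unfolding assms(5) by (intro Max_ge) auto
    then show False by simp
  qed
  then have "ddiff_word (v_word n j m) (schubert_w0 n) = W"
    unfolding dd assms(2) by (intro prod.cong) simp_all
  ultimately show ?thesis by blast
qed

end
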